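(* In the equilibrium (Grossman–Perry–Farrell equilibrium) of the disclosure game described in the context, the informed investor and the partially informed investor always disclose the initial evidence $r$, regardless of its realization.
   Context: **Model.** A firm has value $\theta=rx$, where $r$ and $x$ are independent. $r$ is a continuous variable on $\mathbb{R}^+$ with density $f$ and mean $r_0$; $x$ is a continuous variable on $\mathbb{R}$ with density $g$ and mean $\mu_0$, where $\mu_0>0$ (assumed without loss of generality). An investor learns $r$ with probability $\alpha$ and, conditional on learning $r$, learns $x$ with probability $\beta$. The set of types is $T=\{(r,x),(r,\emptyset),(\emptyset,\emptyset): r\in\mathbb{R}^+,\ x\in\mathbb{R}\}$: type $(r,x)$ is *informed* (knows both), type $(r,\emptyset)$ is *partially informed* (knows only $r$), type $(\emptyset,\emptyset)$ is *uninformed*. The market does not observe the type. *Date 1:* knowing their type, the investor takes a position $\rho\in[-1,1]$ ($\rho<0$ short, $\rho>0$ long, $0$ no trade) at price $P_1=E[\theta]=r_0\mu_0$. *Date 2:* the investor sends a truthful message $m=d(t)\in T$, where $d(\emptyset,\emptyset)=(\emptyset,\emptyset)$, $d(r,\emptyset)\in\{(r,\emptyset),(\emptyset,\emptyset)\}$ and $d(r,x)\in\{(r,x),(r,\emptyset),(\emptyset,\emptyset)\}$; to disclose $r$ means to send a message other than $(\emptyset,\emptyset)$. After the investor's disclosure, $\theta$ is revealed by other sources with probability $q$. *Date 3:* the investor closes the position at the updated price $P_2$, which is $\theta$ if $\theta$ was revealed and $P_2(m)$ otherwise. The investor maximizes the expected profit $E[\rho(P_2-P_1)]$ given their type. **Perfect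 Bayesian equilibrium (PBE).** A strategy profile $\zeta$ such that (i) the investor's disclosure and trading strategy maximizes their expected profit given the market's pricing function $P_2(\cdot)$; (ii) for any message $m\in d(T)$, $P_2(m)=E[\theta\mid t\in d^{-1}(m)]$. **Self-signaling set.** A non-empty set $\chi$ of types is self-signaling relative to $\zeta$ if there exists an off-equilibrium message $m^*$ such that: (i) conditional on receiving $m^*$, the market believes that the investor's type is in $\chi$, i.e. $P_2(m^* )=E[\theta\mid t\in\chi]$; (ii) types in $\chi$ strictly benefit from sending $m^*$; (iii) types not in $\chi$ do not benefit from sending $m^*$. **Grossman–Perry–Farrell equilibrium (GPFE).** A PBE relative to which there is no self-signaling set.
   Formalization: At r = r0 the types (r0,∅) and (r0,μ0) may be indifferent, so they are shown to disclose only if indifferent types disclose; α, β, q are taken below 1; a message sent with conditional probability zero counts as off-equilibrium; strategies are measurable. *)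

theory Defs
  imports "HOL-Probability.Probability"
begin

text \<open>Types of the investor; messages are types as well. \<open>Informed r x\<close>, \<open>Partial r\<close> and
  \<open>Uninformed\<close> stand for \<open>(r, x)\<close>, \<open>(r, \<emptyset>)\<close> and \<open>(\<emptyset>, \<emptyset>)\<close>.\<close>

datatype inv_type = Uninformed | Partial real | Informed real real

definition type_space :: "inv_type set" where
  "type_space = {Uninformed} \<union> {Partial r | r. 0 < r} \<union> {Informed r x | r x. 0 < r}"

text \<open>The truthful messages of a type.\<close>

fun msgs :: "inv_type \<Rightarrow> inv_type set" where
  "msgs Uninformed = {Uninformed}"
| "msgs (Partial r) = {Partial r, Uninformed}"
| "msgs (Informed r x) = {Informed r x, Partial r, Uninformed}"

text \<open>A state \<open>(r, x, a, b)\<close> also records whether the investor learns \<open>r\<close> (namely \<open>a\<close>) and,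
  having learnt \<open>r\<close>, whether they learn \<open>x\<close> (namely \<open>b\<close>).\<close>

type_synonym state = "real \<times> real \<times> bool \<times> bool"

fun firm_value :: "state \<Rightarrow> real" where
  "firm_value (r, x, a, b) = r * x"

fun type_in :: "state \<Rightarrow> inv_type" where
  "type_in (r, x, a, b) = (if a then if b then Informed r x else Partial r else Uninformed)"

definition sender_types :: "(inv_type \<Rightarrow> inv_type) \<Rightarrow> inv_type \<Rightarrow> inv_type set" where
  "sender_types d m = {t \<in> type_space. d t = m}"

locale disclosure_game =
  fixes f g :: "real \<Rightarrow> real"
    and r0 \<mu>0 \<alpha> \<beta> q :: real
  assumes f_density: "\<And>r. 0 \<le> f r" "has_bochner_integral lborel f 1"
    and f_support: "\<And>r. r \<le> 0 \<Longrightarrow> f r = 0"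
    and f_mean: "has_bochner_integral lborel (\<lambda>r. r * f r) r0"
    and g_density: "\<And>x. 0 \<le> g x" "has_bochner_integral lborel g 1"
    and g_mean: "has_bochner_integral lborel (\<lambda>x. x * g x) \<mu>0"
    and mean_pos: "0 < \<mu>0"
    and alpha: "0 \<le> \<alpha>" "\<alpha> < 1"
    and beta: "0 \<le> \<beta>" "\<beta> < 1"
    and q: "0 \<le> q" "q < 1"
begin

text \<open>The law of the state given the hard evidence contained in a message: nothing, the value of
  \<open>r\<close> (so that \<open>r\<close> was learnt), or the values of \<open>r\<close> and \<open>x\<close> (so that both were learnt). These
  regular conditional laws give a meaning to conditional expectations given \<open>t \<in> S\<close> although every
  single value of \<open>r\<close> and \<open>x\<close> has prior probability zero. Senders of a truthful message
  necessarily have its evidence, so conditioning on the evidence loses nothing.\<close>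

fun law :: "inv_type \<Rightarrow> state measure" where
  "law Uninformed =
     density lborel f \<Otimes>\<^sub>M density lborel g \<Otimes>\<^sub>M
     measure_pmf (bernoulli_pmf \<alpha>) \<Otimes>\<^sub>M measure_pmf (bernoulli_pmf \<beta>)"
| "law (Partial r) =
     return borel r \<Otimes>\<^sub>M density lborel g \<Otimes>\<^sub>M
     measure_pmf (return_pmf True) \<Otimes>\<^sub>M measure_pmf (bernoulli_pmf \<beta>)"
| "law (Informed r x) =
     return borel r \<Otimes>\<^sub>M return borel x \<Otimes>\<^sub>M
     measure_pmf (return_pmf True) \<Otimes>\<^sub>M measure_pmf (return_pmf True)"

definition type_prob :: "inv_type \<Rightarrow> inv_type set \<Rightarrow> real" where
  "type_prob m S = measure (law m) (type_in -` S)"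

text \<open>The expectation of \<open>\<theta>\<close> given \<open>t \<in> S\<close>, used only when \<open>type_prob m S > 0\<close>.\<close>

definition cond_value :: "inv_type \<Rightarrow> inv_type set \<Rightarrow> real" where
  "cond_value m S =
     (LINT s : type_in -` S | law m. firm_value s) / type_prob m S"

definition P1 :: real where
  "P1 = r0 * \<mu>0"

text \<open>The expectation of \<open>\<theta>\<close> given the investor's own type; \<open>r\<close> and \<open>x\<close> are independent.\<close>

fun own_value :: "inv_type \<Rightarrow> real" where
  "own_value Uninformed = r0 * \<mu>0"
| "own_value (Partial r) = r * \<mu>0"
| "own_value (Informed r x) = r * x"

text \<open>Expected profit of type \<open>t\<close> from position \<open>\<rho>\<close> and a message that is priced at \<open>p\<close> unless
  \<open>\<theta>\<close> is revealed.\<close>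

definition profit :: "inv_type \<Rightarrow> real \<Rightarrow> real \<Rightarrow> real" where
  "profit t \<rho> p = \<rho> * (q * own_value t + (1 - q) * p - P1)"

definition strategy :: "(inv_type \<Rightarrow> real) \<Rightarrow> (inv_type \<Rightarrow> inv_type) \<Rightarrow> bool" where
  "strategy \<rho> d \<longleftrightarrow>
     (\<forall>t\<in>type_space. \<rho> t \<in> {-1..1} \<and> d t \<in> msgs t) \<and>
     (\<forall>m\<in>type_space. type_in -` sender_types d m \<in> sets (law m))"

text \<open>A message \<open>Partial r\<close> that, given \<open>r\<close>, is sent with probability zero counts as
  off-equilibrium, even if a null set of informed types sends it. \<open>Informed r x\<close> is on the
  equilibrium path iff that type sends it, and \<open>Uninformed\<close> always is.\<close>

definition on_path :: "(inv_type \<Rightarrow> inv_type) \<Rightarrow> inv_type \<Rightarrow> bool" where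
  "on_path d m \<longleftrightarrow> 0 < type_prob m (sender_types d m)"

definition PBE ::
  "(inv_type \<Rightarrow> real) \<Rightarrow> (inv_type \<Rightarrow> inv_type) \<Rightarrow> (inv_type \<Rightarrow> real) \<Rightarrow> bool" where
  "PBE \<rho> d P2 \<longleftrightarrow>
     strategy \<rho> d \<and>
     (\<forall>t\<in>type_space. \<forall>\<rho>'\<in>{-1..1}. \<forall>m\<in>msgs t.
        profit t \<rho>' (P2 m) \<le> profit t (\<rho> t) (P2 (d t))) \<and>
     (\<forall>m\<in>type_space. on_path d m \<longrightarrow> P2 m = cond_value m (sender_types d m))"

text \<open>Type \<open>t\<close> can send \<open>m\<close> and, were \<open>m\<close> priced at \<open>p\<close>, would together with a suitable position
  strictly gain over the profit attained in \<open>(\<rho>, d, P2)\<close>.\<close>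

definition benefits ::
  "(inv_type \<Rightarrow> real) \<Rightarrow> (inv_type \<Rightarrow> inv_type) \<Rightarrow> (inv_type \<Rightarrow> real) \<Rightarrow>
   inv_type \<Rightarrow> inv_type \<Rightarrow> real \<Rightarrow> bool" where
  "benefits \<rho> d P2 t m p \<longleftrightarrow>
     m \<in> msgs t \<and> (\<exists>\<rho>'\<in>{-1..1}. profit t (\<rho> t) (P2 (d t)) < profit t \<rho>' p)"

definition self_signaling ::
  "(inv_type \<Rightarrow> real) \<Rightarrow> (inv_type \<Rightarrow> inv_type) \<Rightarrow> (inv_type \<Rightarrow> real) \<Rightarrow> inv_type set \<Rightarrow> bool" where
  "self_signaling \<rho> d P2 S \<longleftrightarrow>
     S \<noteq> {} \<and> S \<subseteq> type_space \<and>
     (\<exists>m\<in>type_space. \<not> on_path d m \<and> 0 < type_prob m S \<and>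
        (\<forall>t\<in>S. benefits \<rho> d P2 t m (cond_value m S)) \<and>
        (\<forall>t\<in>type_space - S. \<not> benefits \<rho> d P2 t m (cond_value m S)))"

definition GPFE ::
  "(inv_type \<Rightarrow> real) \<Rightarrow> (inv_type \<Rightarrow> inv_type) \<Rightarrow> (inv_type \<Rightarrow> real) \<Rightarrow> bool" where
  "GPFE \<rho> d P2 \<longleftrightarrow> PBE \<rho> d P2 \<and> (\<nexists>S. self_signaling \<rho> d P2 S)"

text \<open>Tie-breaking: a type that has an optimal plan which discloses \<open>r\<close> does disclose it.\<close>

definition discloses_if_indifferent ::
  "(inv_type \<Rightarrow> real) \<Rightarrow> (inv_type \<Rightarrow> inv_type) \<Rightarrow> (inv_type \<Rightarrow> real) \<Rightarrow> bool" where
  "discloses_if_indifferent \<rho> d P2 \<longleftrightarrow>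
     (\<forall>t\<in>type_space.
        (\<exists>m\<in>msgs t - {Uninformed}. \<exists>\<rho>'\<in>{-1..1}.
           profit t \<rho>' (P2 m) = profit t (\<rho> t) (P2 (d t))) \<longrightarrow> d t \<noteq> Uninformed)"

end

end

theory Submission
  imports Defs
begin

text \<open>With the optimal position, a type of expected value \<open>v\<close> whose message is priced at \<open>p\<close> earns
  \<open>\<bar>q v + (1 - q) p - P1\<bar>\<close>. Since a type \<open>(r, x)\<close> that does not reveal itself could be self-signaling,
  it earns at least \<open>\<bar>r x - P1\<bar>\<close>; hence an informed type that pools at a price \<open>p \<ge> P1\<close> has value at
  most \<open>p\<close>, and symmetrically for \<open>p \<le> P1\<close>.

  Let \<open>A\<close> be the price of non-disclosure and suppose \<open>A \<ge> P1\<close>. If a partially informed type hides \<open>r\<close>,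
  then the message \<open>(r, \<emptyset>)\<close> is off path. For \<open>p \<ge> A\<close> the informed types that would gain from the price
  \<open>p\<close> are those with values in the interval from \<open>(2 P1 - (1 - q) p) / (1 + q)\<close> to \<open>p\<close>, and at \<open>p = A\<close>
  these are up to a null set those that hide. If the types hiding \<open>r\<close> had a mean value above \<open>A\<close>, the intermediate
  value theorem would give a price of \<open>(r, \<emptyset>)\<close> equal to the mean value of the types gaining from it,
  that is, a self-signaling set. So for every \<open>r\<close> the hiding types pull the price of the pool weakly
  below \<open>A\<close>. As the uninformed have mean value \<open>P1\<close>, this forces \<open>A = P1\<close>; the case \<open>A \<le> P1\<close> is
  symmetric. At the price \<open>P1\<close> only types of value \<open>P1\<close> can hide.\<close>

section \<open>Expectations over the law of the state\<close>

lemma integrable_pair_mult: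
  fixes u :: "'a \<Rightarrow> real" and v :: "'b \<Rightarrow> real"
  assumes "prob_space M" "prob_space N" and u: "integrable M u" and v: "integrable N v"
  shows "integrable (M \<Otimes>\<^sub>M N) (\<lambda>z. u (fst z) * v (snd z))"
proof -
  interpret M: prob_space M by fact
  interpret N: prob_space N by fact
  interpret pair_prob_space M N ..
  have [measurable]: "u \<in> borel_measurable M" "v \<in> borel_measurable N"
    using u v by auto
  show ?thesis
    by (rule Fubini_integrable) (use u v in \<open>auto simp: abs_mult\<close>)
qed

text \<open>The product of discrete sigma-algebras on countable spaces is again discrete.\<close>

lemma measurable_bool_pair:
  "k \<in> borel_measurable (measure_pmf p \<Otimes>\<^sub>M measure_pmf p')"
  for k :: "bool \<times> bool \<Rightarrow> real"
proof -
  have "sets (measure_pmf p \<Otimes>\<^sub>M measure_pmf p') =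
      sets (count_space (UNIV :: bool set) \<Otimes>\<^sub>M count_space (UNIV :: bool set))"
    by (intro sets_pair_measure_cong) auto
  also have "\<dots> = sets (count_space UNIV)"
    by (subst pair_measure_countable) auto
  finally show ?thesis
    by (simp add: measurable_def)
qed

lemma integral_bool_pair:
  fixes k :: "bool \<times> bool \<Rightarrow> real"
  assumes "a \<in> {0..1}" "b \<in> {0..1}"
  shows "(\<integral>z. k z \<partial>(measure_pmf (bernoulli_pmf a) \<Otimes>\<^sub>M measure_pmf (bernoulli_pmf b))) =
    (1 - a) * ((1 - b) * k (False, False) + b * k (False, True)) +
    a * ((1 - b) * k (True, False) + b * k (True, True))" (is "integral\<^sup>L ?Q k = _")
proof -
  interpret Q: pair_prob_space "measure_pmf (bernoulli_pmf a)" "measure_pmf (bernoulli_pmf b)" ..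
  \<comment> \<open>On a finite space the sum of all absolute values bounds \<open>k\<close>, which
    gives integrability.\<close>
  have "\<bar>k z\<bar> \<le> (\<Sum>z\<in>UNIV. \<bar>k z\<bar>)" for z
    by (intro member_le_sum) auto
  then have "integrable ?Q k"
    by (intro Q.P.integrable_const_bound[where B = "\<Sum>z\<in>UNIV. \<bar>k z\<bar>"])
      (auto intro: measurable_bool_pair)
  from Q.integral_fst'[OF this, symmetric] show ?thesis
    using assms by (simp add: algebra_simps)
qed

text \<open>With \<open>return borel\<close> for a known variable and parameter 1 for a known event,
  this covers all three cases of \<open>law\<close>, so that Fubini is applied only once.\<close>

abbreviation state_law :: "real measure \<Rightarrow> real measure \<Rightarrow> real \<Rightarrow> real \<Rightarrow> state measure" where
  "state_law M N a b \<equiv>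
     M \<Otimes>\<^sub>M N \<Otimes>\<^sub>M measure_pmf (bernoulli_pmf a) \<Otimes>\<^sub>M measure_pmf (bernoulli_pmf b)"

lemma return_pmf_True_bernoulli: "return_pmf True = bernoulli_pmf 1"
proof (rule pmf_eqI)
  show "pmf (return_pmf True) i = pmf (bernoulli_pmf 1) i" for i
    by (cases i) auto
qed

text \<open>Sets of types carry no sigma-algebra of their own. Their informed part inherits
  measurability from the state space as a section with \<open>r\<close> and both flags
  fixed.\<close>

lemma type_in_vimage_measurable:
  assumes S: "type_in -` S \<in> sets (state_law M N a b)" and "sets M = sets borel" "sets N = sets borel"
  shows "{x. Informed r x \<in> S} \<in> sets borel"
proof -
  have [simp]: "space M = UNIV" "space N = UNIV"
    using sets_eq_imp_space_eq[OF assms(2)] sets_eq_imp_space_eq[OF assms(3)] by auto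
  have "(\<lambda>x. (r, x, True, True)) \<in> N \<rightarrow>\<^sub>M state_law M N a b"
    by (auto intro!: measurable_Pair)
  from measurable_sets[OF this S] show ?thesis
    using assms(3) by (simp add: vimage_def)
qed

text \<open>Fubini with \<open>r\<close> outermost, then \<open>x\<close>, then the two flags. The
  outer integral over \<open>r\<close> is kept because the sign of its integrand is later analysed
  for each \<open>r\<close> separately.\<close>

lemma state_law_integral:
  assumes M: "prob_space M" "sets M = sets borel" "integrable M (\<lambda>r. r)"
    and N: "prob_space N" "sets N = sets borel" "integrable N (\<lambda>x. x)"
    and ab: "a \<in> {0..1}" "b \<in> {0..1}"
    and S: "type_in -` S \<in> sets (state_law M N a b)"
  shows "integrable (state_law M N a b) (\<lambda>s. indicator (type_in -` S) s * (firm_value s - p))"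
    and "(\<integral>s. indicator (type_in -` S) s * (firm_value s - p) \<partial>state_law M N a b) =
      (\<integral>r. (1 - a) * indicator S Uninformed * (r * (\<integral>x. x \<partial>N) - p) +
         a * ((1 - b) * indicator S (Partial r) * (r * (\<integral>x. x \<partial>N) - p) +
           b * (\<integral>x. indicator S (Informed r x) * (r * x - p) \<partial>N)) \<partial>M)"
    and "integrable M (\<lambda>r. (1 - a) * indicator S Uninformed * (r * (\<integral>x. x \<partial>N) - p) +
         a * ((1 - b) * indicator S (Partial r) * (r * (\<integral>x. x \<partial>N) - p) +
           b * (\<integral>x. indicator S (Informed r x) * (r * x - p) \<partial>N)))"
proof -
  let ?L = "state_law M N a b"
  let ?Q = "measure_pmf (bernoulli_pmf a) \<Otimes>\<^sub>M measure_pmf (bernoulli_pmf b)"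
  let ?h = "\<lambda>s. indicator (type_in -` S) s * (firm_value s - p)"
  interpret M: prob_space M by fact
  interpret N: prob_space N by fact
  interpret Q: pair_prob_space "measure_pmf (bernoulli_pmf a)" "measure_pmf (bernoulli_pmf b)" ..
  interpret NQ: pair_prob_space N ?Q ..
  interpret L: pair_prob_space M "N \<Otimes>\<^sub>M ?Q" ..
  have [simp]: "space M = UNIV" "space N = UNIV"
    using sets_eq_imp_space_eq[OF M(2)] sets_eq_imp_space_eq[OF N(2)] by auto
  note [measurable_cong] = M(2) N(2)
  have "integrable (N \<Otimes>\<^sub>M ?Q) (\<lambda>z. fst z * 1)"
    using integrable_pair_mult[OF N(1) Q.P.prob_space_axioms N(3), of "\<lambda>_. 1"] by simp
  then have x: "integrable (N \<Otimes>\<^sub>M ?Q) (\<lambda>z. fst z)"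
    by simp
  have "integrable ?L (\<lambda>z. fst z * fst (snd z))"
    by (rule integrable_pair_mult[OF M(1) NQ.P.prob_space_axioms M(3) x])
  moreover have "(\<lambda>z. fst z * fst (snd z)) = firm_value"
    by auto
  ultimately have "integrable ?L firm_value"
    by simp
  then have "integrable ?L (\<lambda>s. firm_value s - p)"
    by auto
  from integrable_mult_indicator[OF S this] show h: "integrable ?L ?h"
    by simp
  have hr: "integrable (N \<Otimes>\<^sub>M ?Q) (\<lambda>y. ?h (r, y))" for r
  proof -
    have "(\<lambda>y. (r, y)) \<in> N \<Otimes>\<^sub>M ?Q \<rightarrow>\<^sub>M ?L"
      by (auto intro!: measurable_Pair)
    from measurable_sets[OF this S]
    have A: "{y. (r, y) \<in> type_in -` S} \<in> sets (N \<Otimes>\<^sub>M ?Q)"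
      by (simp add: vimage_def space_pair_measure)
    have "integrable (N \<Otimes>\<^sub>M ?Q) (\<lambda>y. r * fst y - p)"
      using x by auto
    from integrable_mult_indicator[OF A this] show ?thesis
      by (rule back_subst[of "integrable _"]) (auto simp: indicator_def)
  qed
  have hrx: "(\<integral>y. ?h (r, y) \<partial>(N \<Otimes>\<^sub>M ?Q)) =
      (1 - a) * indicator S Uninformed * (r * (\<integral>x. x \<partial>N) - p) +
         a * ((1 - b) * indicator S (Partial r) * (r * (\<integral>x. x \<partial>N) - p) +
           b * (\<integral>x. indicator S (Informed r x) * (r * x - p) \<partial>N))" for r
  proof -
    have I: "integrable N (\<lambda>x. r * x - p)"
      using N(3) by auto
    have "integrable N (\<lambda>x. indicator {x. Informed r x \<in> S} x *\<^sub>R (r * x - p))"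
      using type_in_vimage_measurable[OF S M(2) N(2)] I by (intro integrable_mult_indicator) (auto simp: N(2))
    then have J: "integrable N (\<lambda>x. indicator S (Informed r x) * (r * x - p))"
      by (rule back_subst[of "integrable _"]) (auto simp: indicator_def)
    have "(\<integral>y. ?h (r, y) \<partial>(N \<Otimes>\<^sub>M ?Q)) = (\<integral>x. (\<integral>z. ?h (r, x, z) \<partial>?Q) \<partial>N)"
      using NQ.integral_fst'[OF hr[of r]] by simp
    \<comment> \<open>Whether the uninformed or the partially informed type lies in \<open>S\<close>
      does not depend on \<open>x\<close>, so these two contribute through the mean of
      \<open>x\<close> alone.\<close>
    also have "\<dots> = (\<integral>x. ((1 - a) * indicator S Uninformed + a * (1 - b) * indicator S (Partial r)) * (r * x - p) +
        a * b * (indicator S (Informed r x) * (r * x - p)) \<partial>N)"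
      by (intro Bochner_Integration.integral_cong refl, subst integral_bool_pair[OF ab])
        (auto simp: indicator_def algebra_simps)
    also have "\<dots> = ((1 - a) * indicator S Uninformed + a * (1 - b) * indicator S (Partial r)) *
        (\<integral>x. r * x - p \<partial>N) + a * b * (\<integral>x. indicator S (Informed r x) * (r * x - p) \<partial>N)"
      using I J by (subst Bochner_Integration.integral_add) auto
    also have "(\<integral>x. r * x - p \<partial>N) = r * (\<integral>x. x \<partial>N) - p"
      using N(3) N.prob_space by simp
    finally show ?thesis
      by (simp add: algebra_simps)
  qed
  show "integral\<^sup>L ?L ?h = (\<integral>r. (1 - a) * indicator S Uninformed * (r * (\<integral>x. x \<partial>N) - p) +
         a * ((1 - b) * indicator S (Partial r) * (r * (\<integral>x. x \<partial>N) - p) +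
           b * (\<integral>x. indicator S (Informed r x) * (r * x - p) \<partial>N)) \<partial>M)"
    using L.integral_fst'[OF h] by (simp add: hrx)
  show "integrable M (\<lambda>r. (1 - a) * indicator S Uninformed * (r * (\<integral>x. x \<partial>N) - p) +
         a * ((1 - b) * indicator S (Partial r) * (r * (\<integral>x. x \<partial>N) - p) +
           b * (\<integral>x. indicator S (Informed r x) * (r * x - p) \<partial>N)))"
    using L.integrable_fst'[OF h] by (simp add: hrx)
qed

lemma prob_space_state_law:
  assumes "prob_space M" "prob_space N"
  shows "prob_space (state_law M N a b)"
proof -
  interpret M: prob_space M by fact
  interpret N: prob_space N by fact
  interpret Q: pair_prob_space "measure_pmf (bernoulli_pmf a)" "measure_pmf (bernoulli_pmf b)" ..
  interpret NQ: pair_prob_space N "measure_pmf (bernoulli_pmf a) \<Otimes>\<^sub>M measure_pmf (bernoulli_pmf b)" ..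
  interpret L: pair_prob_space M
    "N \<Otimes>\<^sub>M measure_pmf (bernoulli_pmf a) \<Otimes>\<^sub>M measure_pmf (bernoulli_pmf b)" ..
  show ?thesis by (rule L.P.prob_space_axioms)
qed

lemma state_law_gap:
  assumes M: "prob_space M" "sets M = sets borel" "integrable M (\<lambda>r. r)"
    and N: "prob_space N" "sets N = sets borel" "integrable N (\<lambda>x. x)"
    and ab: "a \<in> {0..1}" "b \<in> {0..1}"
    and S: "type_in -` S \<in> sets (state_law M N a b)"
  shows "(\<integral>s. indicator (type_in -` S) s * (firm_value s - p) \<partial>state_law M N a b) =
    (LINT s : type_in -` S | state_law M N a b. firm_value s) - p * measure (state_law M N a b) (type_in -` S)"
proof -
  interpret L: prob_space "state_law M N a b"
    by (rule prob_space_state_law[OF M(1) N(1)])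
  have 1: "integrable (state_law M N a b) (\<lambda>s. indicator (type_in -` S) s * firm_value s)"
    using state_law_integral(1)[OF M N ab S, of 0] by simp
  have 2: "integrable (state_law M N a b) (\<lambda>s. p * indicator (type_in -` S) s)"
    using S by (intro integrable_mult_right integrable_real_indicator) (auto simp: L.emeasure_eq_measure)
  have "(\<integral>s. indicator (type_in -` S) s * (firm_value s - p) \<partial>state_law M N a b) =
      (\<integral>s. indicator (type_in -` S) s * firm_value s - p * indicator (type_in -` S) s \<partial>state_law M N a b)"
    by (simp add: algebra_simps)
  also have "\<dots> = (LINT s : type_in -` S | state_law M N a b. firm_value s) - p * measure (state_law M N a b) (type_in -` S)"
    using S 1 2 sets.sets_into_space[OF S] by (simp add: set_lebesgue_integral_def Int_absorb2)
  finally show ?thesis .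
qed

lemma return_borel:
  fixes r :: real
  shows "prob_space (return borel r)" "sets (return borel r) = sets borel"
    "integrable (return borel r) (\<lambda>x. x)" "(\<integral>x. x \<partial>return borel r) = r"
proof -
  show "prob_space (return borel r)" by (rule prob_space_return) simp
  then interpret prob_space "return borel r" .
  show "integrable (return borel r) (\<lambda>x. x)"
    by (rule integrable_const_bound[where B = "\<bar>r\<bar>"]) (auto simp: AE_return)
qed (auto simp: integral_return)

lemma type_in_vimage_sets:
  assumes "sets M = sets borel" "sets N = sets borel" "X \<in> sets borel"
  shows "type_in -` {Uninformed} \<in> sets (state_law M N a b)"
    and "type_in -` {Informed r x} \<in> sets (state_law M N a b)"
    and "type_in -` ({Partial r} \<union> Informed r ` X) \<in> sets (state_law M N a b)"
proof -
  have 1: "type_in -` {Uninformed} = UNIV \<times> UNIV \<times> {False} \<times> UNIV"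
    by (auto split: if_splits)
  have 2: "type_in -` {Informed r x} = {r} \<times> {x} \<times> {True} \<times> {True}"
    by (auto split: if_splits)
  have 3: "type_in -` ({Partial r} \<union> Informed r ` X) =
      {r} \<times> (UNIV \<times> {True} \<times> {False} \<union> X \<times> {True} \<times> {True})"
    by (auto split: if_splits)
  show "type_in -` {Uninformed} \<in> sets (state_law M N a b)"
    "type_in -` {Informed r x} \<in> sets (state_law M N a b)"
    "type_in -` ({Partial r} \<union> Informed r ` X) \<in> sets (state_law M N a b)"
    unfolding 1 2 3 using assms by ((intro pair_measureI sets.Un; simp)+)
qed

lemma density_facts:
  fixes g :: "real \<Rightarrow> real"
  assumes g: "\<And>x. 0 \<le> g x" "has_bochner_integral lborel g 1"
    and m: "has_bochner_integral lborel (\<lambda>x. x * g x) m"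
  shows "prob_space (density lborel g)" "integrable (density lborel g) (\<lambda>x. x)"
    "(\<integral>x. x \<partial>density lborel g) = m" "AE x in density lborel g. x \<noteq> c"
proof -
  have [measurable]: "g \<in> borel_measurable borel"
    using g(2) by (auto simp: has_bochner_integral_iff)
  have "(\<integral>\<^sup>+ x. ennreal (g x) \<partial>lborel) = 1"
    using g by (subst nn_integral_eq_integral) (auto simp: has_bochner_integral_iff)
  then show "prob_space (density lborel g)"
    by (intro prob_spaceI) (simp add: emeasure_density)
  show "integrable (density lborel g) (\<lambda>x. x)"
    using m g(1) by (subst integrable_density) (auto simp: has_bochner_integral_iff mult.commute)
  show "(\<integral>x. x \<partial>density lborel g) = m"
    using m g(1) by (subst integral_density) (auto simp: has_bochner_integral_iff mult.commute)
  show "AE x in density lborel g. x \<noteq> c"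
    using AE_lborel_singleton[of c] by (subst AE_density) (auto elim!: eventually_mono)
qed

section \<open>Comparing a pooled price with full revelation\<close>

text \<open>With w = v - c and e = (1 - q) (p - c) \<ge> 0 the inequality reads |w| < |q w + e|. The
  two sides agree exactly at w = e / (1 - q), which is v = p, and at w = - e / (1 + q), which is the
  lower endpoint.\<close>

lemma prefers_iff:
  fixes q c p v :: real
  assumes "0 \<le> q" "q < 1" "c \<le> p"
  shows "\<bar>v - c\<bar> < \<bar>q * v + (1 - q) * p - c\<bar> \<longleftrightarrow> (2 * c - (1 - q) * p) / (1 + q) < v \<and> v < p"
proof -
  define e where "e = (1 - q) * (p - c)"
  have e: "0 \<le> e" using assms by (simp add: e_def)
  have 0: "q * v + (1 - q) * p - c = q * (v - c) + e"
    by (simp add: e_def algebra_simps)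
  have 1: "(2 * c - (1 - q) * p) / (1 + q) < v \<longleftrightarrow> - e < (1 + q) * (v - c)"
    using assms by (simp add: e_def divide_less_eq algebra_simps)
  have 2: "v < p \<longleftrightarrow> (1 - q) * (v - c) < e"
    using assms by (simp add: e_def)
  have 3: "q * (v - c) \<le> v - c" if "v - c \<ge> 0"
    using that assms by (simp add: mult_left_le_one_le)
  have 4: "v - c \<le> q * (v - c)" "q * (v - c) \<le> 0" if "v - c \<le> 0"
    using mult_right_mono_neg[OF _ that, of q 1] that assms by (auto simp: mult_nonneg_nonpos)
  have 5: "0 \<le> q * (v - c)" if "v - c \<ge> 0" using that assms by simp
  show ?thesis
    unfolding 0 1 2 using e 3 4 5 by (auto simp: abs_if algebra_simps; (linarith | argo))
qed

text \<open>A higher price raises the argument of the absolute value. Its absolute value rises too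
  once the sum of the two arguments is positive, and the lower endpoint for \<open>p\<close>
  guarantees that.\<close>

lemma prefers_between:
  fixes q c A p v :: real
  assumes "0 \<le> q" "q < 1" "c \<le> A" "A < p"
    and "(2 * c - (1 - q) * p) / (1 + q) < v"
  shows "\<bar>q * v + (1 - q) * A - c\<bar> < \<bar>q * v + (1 - q) * p - c\<bar>"
proof -
  have s: "(1 - q) * A < (1 - q) * p" using assms by simp
  have "2 * c - (1 - q) * p < (1 + q) * v"
    using assms by (simp add: divide_less_eq mult.commute)
  then have "q * (2 * c - (1 - q) * p) \<le> q * ((1 + q) * v)"
    using assms by (intro mult_left_mono) auto
  moreover have "(1 - q) * (1 + q) * c \<le> (1 - q) * (1 + q) * A"
    using assms by (intro mult_left_mono) auto
  moreover have "(1 - q) * (1 - q) * c < (1 - q) * (1 - q) * p"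
    using assms by (intro mult_strict_left_mono) auto
  \<comment> \<open>The bracket is the sum of the two arguments. Scaled by 1 + q, its positivity is
    the sum of the three inequalities with the first one taken twice.\<close>
  ultimately have "0 < (1 + q) * (2 * q * v + (1 - q) * A + (1 - q) * p - 2 * c)"
    by (simp add: algebra_simps)
  then have "0 < 2 * q * v + (1 - q) * A + (1 - q) * p - 2 * c"
    using assms by (simp add: zero_less_mult_iff)
  with s show ?thesis by (auto simp: abs_if)
qed

section \<open>Continuity of the pool and existence of a fixed-point price\<close>

lemma eventually_less_iff:
  fixes u :: "nat \<Rightarrow> real"
  assumes "u \<longlonglongrightarrow> p" "v \<noteq> p"
  shows "\<forall>\<^sub>F n in sequentially. v < u n \<longleftrightarrow> v < p"
proof (cases "v < p")
  case True
  show ?thesis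
    using order_tendstoD(1)[OF assms(1) True] by eventually_elim (simp add: True)
next
  case False
  then have "p < v" using assms(2) by simp
  from order_tendstoD(2)[OF assms(1) this] show ?thesis
    by eventually_elim (use False in simp)
qed

text \<open>Dominated convergence: the indicator can jump only where \<open>V x\<close> equals an
  endpoint of the limiting interval, and these points form a null set.\<close>

lemma continuous_on_truncated_mean:
  fixes V :: "'a \<Rightarrow> real" and L :: "real \<Rightarrow> real"
  assumes "prob_space M" and V: "integrable M V" and atomless: "\<And>c. AE x in M. V x \<noteq> c"
    and L: "continuous_on UNIV L"
  shows "continuous_on UNIV (\<lambda>p. \<integral>x. indicator {L p<..<p} (V x) * (V x - p) \<partial>M)"
proof (rule continuous_on_sequentiallyI)
  interpret prob_space M by fact
  fix u :: "nat \<Rightarrow> real" and p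
  assume u: "u \<longlonglongrightarrow> p"
  then have Lu: "(\<lambda>n. L (u n)) \<longlonglongrightarrow> L p"
    using L continuous_on_tendsto_compose by fastforce
  \<comment> \<open>A convergent sequence is bounded, so \<open>\<bar>V x\<bar> + K\<close>
    dominates every integrand.\<close>
  obtain K where K: "\<And>n. norm (u n) \<le> K"
    using convergent_imp_Bseq[OF convergentI[OF u]] by (auto simp: Bseq_def)
  have [measurable]: "V \<in> borel_measurable M"
    using V by auto
  show "(\<lambda>n. \<integral>x. indicator {L (u n)<..<u n} (V x) * (V x - u n) \<partial>M)
      \<longlonglongrightarrow> (\<integral>x. indicator {L p<..<p} (V x) * (V x - p) \<partial>M)"
  proof (rule integral_dominated_convergence[where w = "\<lambda>x. \<bar>V x\<bar> + K"])
    show "integrable M (\<lambda>x. \<bar>V x\<bar> + K)"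
      using V by auto
    show "AE x in M. (\<lambda>n. indicator {L (u n)<..<u n} (V x) * (V x - u n))
        \<longlonglongrightarrow> indicator {L p<..<p} (V x) * (V x - p)"
      using atomless[of p] atomless[of "L p"]
    proof eventually_elim
      case (elim x)
      have "\<forall>\<^sub>F n in sequentially. V x < u n \<longleftrightarrow> V x < p"
        using eventually_less_iff[OF u elim(1)] .
      moreover have "\<forall>\<^sub>F n in sequentially. V x < L (u n) \<longleftrightarrow> V x < L p"
        using eventually_less_iff[OF Lu elim(2)] .
      \<comment> \<open>The strict comparison with \<open>L (u n)\<close> leaves equality open;
        excluding it makes the indicator eventually constant.\<close>
      moreover have "\<forall>\<^sub>F n in sequentially. V x \<noteq> L (u n)"
        using tendsto_imp_eventually_ne[OF Lu, of "V x"] elim(2) by (auto elim!: eventually_mono)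
      ultimately have "\<forall>\<^sub>F n in sequentially.
          indicator {L p<..<p} (V x) * (V x - u n) = indicator {L (u n)<..<u n} (V x) * (V x - u n)"
        by eventually_elim (use elim(2) in \<open>auto simp: indicator_def\<close>)
      moreover have "(\<lambda>n. indicator {L p<..<p} (V x) * (V x - u n)) \<longlonglongrightarrow> indicator {L p<..<p} (V x) * (V x - p)"
        by (intro tendsto_intros u)
      ultimately show ?case
        by (rule Lim_transform_eventually[rotated])
    qed
    show "AE x in M. norm (indicator {L (u n)<..<u n} (V x) * (V x - u n)) \<le> \<bar>V x\<bar> + K" for n
      using K[of n] by (auto simp: indicator_def)
  qed auto
qed

text \<open>\<open>v0\<close> is the value of the partially informed type and \<open>V\<close> that of the informed types with the
  same \<open>r\<close>; \<open>c\<close> stands for \<open>P1\<close>. The price \<open>p\<close> is a fixed point (the mean value of the partially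
  informed type together with the informed types that prefer \<open>p\<close> to their own value) iff this is \<open>0\<close>.\<close>

definition pool_gap :: "'a measure \<Rightarrow> ('a \<Rightarrow> real) \<Rightarrow> real \<Rightarrow> real \<Rightarrow> real \<Rightarrow> real \<Rightarrow> real \<Rightarrow> real" where
  "pool_gap M V v0 \<beta> q c p = (1 - \<beta>) * (v0 - p) +
     \<beta> * (\<integral>x. indicator {v. \<bar>v - c\<bar> < \<bar>q * v + (1 - q) * p - c\<bar>} (V x) * (V x - p) \<partial>M)"

lemma integral_nonpos:
  fixes h :: "'a \<Rightarrow> real"
  assumes "\<And>x. x \<in> space M \<Longrightarrow> h x \<le> 0"
  shows "integral\<^sup>L M h \<le> 0"
proof -
  have "0 \<le> (\<integral>x. - h x \<partial>M)"
    using assms by (intro Bochner_Integration.integral_nonneg) auto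
  then show ?thesis by simp
qed

text \<open>Let the price rise from \<open>A\<close> to \<open>v0\<close>. At \<open>v0\<close> the
  first term of the gap vanishes, and the integral is nonpositive because only values below the
  price enter it; the intermediate value theorem yields a zero. The last claim ensures that types
  pooled at \<open>A\<close> also gain from the new price when they prefer it to revelation.\<close>

lemma pool_gap_fixpoint_above:
  fixes V :: "'a \<Rightarrow> real"
  assumes "prob_space M" "integrable M V" "\<And>c. AE x in M. V x \<noteq> c"
    and b: "0 \<le> \<beta>" "\<beta> < 1" and q: "0 \<le> q" "q < 1" and A: "c \<le> A"
    and gap: "0 < pool_gap M V v0 \<beta> q c A"
  obtains p where "pool_gap M V v0 \<beta> q c p = 0"
    "\<bar>q * v0 + (1 - q) * A - c\<bar> < \<bar>q * v0 + (1 - q) * p - c\<bar>"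
    "\<And>v. \<bar>v - c\<bar> < \<bar>q * v + (1 - q) * p - c\<bar> \<Longrightarrow>
       \<bar>q * v + (1 - q) * A - c\<bar> < \<bar>q * v + (1 - q) * p - c\<bar>"
proof -
  let ?L = "\<lambda>p. (2 * c - (1 - q) * p) / (1 + q)"
  let ?G = "\<lambda>p. (1 - \<beta>) * (v0 - p) + \<beta> * (\<integral>x. indicator {?L p<..<p} (V x) * (V x - p) \<partial>M)"
  have G: "pool_gap M V v0 \<beta> q c p = ?G p" if "A \<le> p" for p
  proof -
    have "{v. \<bar>v - c\<bar> < \<bar>q * v + (1 - q) * p - c\<bar>} = {?L p<..<p}"
      using prefers_iff[OF q order_trans[OF A that]] by (simp add: set_eq_iff)
    then show ?thesis by (simp add: pool_gap_def)
  qed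
  have neg: "\<beta> * (\<integral>x. indicator {?L p<..<p} (V x) * (V x - p) \<partial>M) \<le> 0" for p
    using b by (intro mult_nonneg_nonpos[OF b(1)] integral_nonpos) (auto simp: indicator_def)
  \<comment> \<open>Otherwise both terms of the gap at \<open>A\<close> would be
    nonpositive.\<close>
  have v0: "A < v0"
  proof (rule ccontr)
    assume "\<not> A < v0"
    then have "(1 - \<beta>) * (v0 - A) \<le> 0" using b by (intro mult_nonneg_nonpos) auto
    with gap G[of A] neg[of A] show False by simp
  qed
  have "continuous_on UNIV (\<lambda>p. \<integral>x. indicator {?L p<..<p} (V x) * (V x - p) \<partial>M)"
    by (rule continuous_on_truncated_mean[OF assms(1-3)]) (use q in \<open>auto intro!: continuous_intros\<close>)
  then have cont: "continuous_on UNIV ?G"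
    by (intro continuous_intros) auto
  have "\<exists>p\<ge>A. p \<le> v0 \<and> ?G p = 0"
    using v0 neg[of v0] gap G[of A]
    by (intro IVT2' continuous_on_subset[OF cont]) auto
  then obtain p where p: "A \<le> p" "?G p = 0" by blast
  with gap G[of A] have "A < p" by (cases "p = A") auto
  have "p \<le> v0"
  proof (rule ccontr)
    assume "\<not> p \<le> v0"
    then have "(1 - \<beta>) * (v0 - p) < 0" using b by (intro mult_pos_neg) auto
    with neg[of p] p show False by simp
  qed
  have *: "\<bar>q * v + (1 - q) * A - c\<bar> < \<bar>q * v + (1 - q) * p - c\<bar>" if "?L p < v" for v
    using prefers_between[OF q A \<open>A < p\<close> that] .
  \<comment> \<open>As c \<le> A < v0, both absolute values have nonnegative arguments, and the
    higher price gives the larger one.\<close>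
  have "(1 - q) * c \<le> (1 - q) * A" "q * A \<le> q * v0"  "(1 - q) * A < (1 - q) * p"
    using q A v0 \<open>A < p\<close> by (auto intro!: mult_left_mono)
  moreover have "q * c \<le> q * A" using q A by (intro mult_left_mono) auto
  ultimately have "\<bar>q * v0 + (1 - q) * A - c\<bar> < \<bar>q * v0 + (1 - q) * p - c\<bar>"
    by (auto simp: abs_if algebra_simps)
  moreover have "pool_gap M V v0 \<beta> q c p = 0"
    using p G[of p] by simp
  moreover have "\<bar>q * v + (1 - q) * A - c\<bar> < \<bar>q * v + (1 - q) * p - c\<bar>"
    if "\<bar>v - c\<bar> < \<bar>q * v + (1 - q) * p - c\<bar>" for v
    using * that prefers_iff[OF q order_trans[OF A p(1)]] by blast
  ultimately show ?thesis
    using that[of p] by blast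
qed

text \<open>Negating all values and prices swaps long and short positions and leaves the attainable
  profits unchanged. This reflection carries results for prices above \<open>c\<close> to prices
  below it.\<close>

lemma pool_gap_minus: "pool_gap M (\<lambda>x. - V x) (- v0) \<beta> q (- c) (- p) = - pool_gap M V v0 \<beta> q c p"
proof -
  have "\<bar>- v + c\<bar> < \<bar>- (q * v) - (1 - q) * p + c\<bar> \<longleftrightarrow>
      \<bar>v - c\<bar> < \<bar>q * v + (1 - q) * p - c\<bar>" for v
    by linarith
  then have "(\<integral>x. indicator {v. \<bar>v - (- c)\<bar> < \<bar>q * v + (1 - q) * (- p) - (- c)\<bar>} (- V x) * (- V x - (- p)) \<partial>M) =
     - (\<integral>x. indicator {v. \<bar>v - c\<bar> < \<bar>q * v + (1 - q) * p - c\<bar>} (V x) * (V x - p) \<partial>M)"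
    unfolding integral_minus[symmetric]
    by (intro Bochner_Integration.integral_cong) (auto simp: indicator_def)
  then show ?thesis
    unfolding pool_gap_def by (simp only:) (simp add: algebra_simps)
qed

lemma pool_gap_fixpoint:
  fixes V :: "'a \<Rightarrow> real"
  assumes M: "prob_space M" "integrable M V" "\<And>c. AE x in M. V x \<noteq> c"
    and b: "0 \<le> \<beta>" "\<beta> < 1" and q: "0 \<le> q" "q < 1"
    and A: "c \<le> A \<and> 0 < pool_gap M V v0 \<beta> q c A \<or> A \<le> c \<and> pool_gap M V v0 \<beta> q c A < 0"
  obtains p where "pool_gap M V v0 \<beta> q c p = 0"
    "\<bar>q * v0 + (1 - q) * A - c\<bar> < \<bar>q * v0 + (1 - q) * p - c\<bar>"
    "\<And>v. \<bar>v - c\<bar> < \<bar>q * v + (1 - q) * p - c\<bar> \<Longrightarrow>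
       \<bar>q * v + (1 - q) * A - c\<bar> < \<bar>q * v + (1 - q) * p - c\<bar>"
  using A
proof
  assume "c \<le> A \<and> 0 < pool_gap M V v0 \<beta> q c A"
  then show ?thesis using pool_gap_fixpoint_above[OF M b q] that by blast
next
  assume *: "A \<le> c \<and> pool_gap M V v0 \<beta> q c A < 0"
  have "AE x in M. - V x \<noteq> c" for c
    using M(3)[of "- c"] by (auto elim!: eventually_mono)
  moreover have "integrable M (\<lambda>x. - V x)" using M by auto
  ultimately obtain p where p: "pool_gap M (\<lambda>x. - V x) (- v0) \<beta> q (- c) p = 0"
    "\<bar>q * - v0 + (1 - q) * - A - - c\<bar> < \<bar>q * - v0 + (1 - q) * p - - c\<bar>"
    "\<And>v. \<bar>v - - c\<bar> < \<bar>q * v + (1 - q) * p - - c\<bar> \<Longrightarrow>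
       \<bar>q * v + (1 - q) * - A - - c\<bar> < \<bar>q * v + (1 - q) * p - - c\<bar>"
    using pool_gap_fixpoint_above[OF M(1) _ _ b q, of "\<lambda>x. - V x" "- c" "- A" "- v0"] *
    by (auto simp: pool_gap_minus)
  have flip: "\<bar>q * - v + (1 - q) * - u - - c\<bar> = \<bar>q * v + (1 - q) * u - c\<bar>" for u v
    using abs_minus_cancel[of "q * v + (1 - q) * u - c"] by (simp add: algebra_simps)
  show ?thesis
  proof (rule that[of "- p"])
    show "pool_gap M V v0 \<beta> q c (- p) = 0"
      using p(1) pool_gap_minus[of M V v0 \<beta> q c "- p"] by simp
    show "\<bar>q * v0 + (1 - q) * A - c\<bar> < \<bar>q * v0 + (1 - q) * - p - c\<bar>"
      using p(2) flip[of v0 A] flip[of v0 "- p"] by simp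
    show "\<bar>q * v + (1 - q) * A - c\<bar> < \<bar>q * v + (1 - q) * - p - c\<bar>"
      if "\<bar>v - c\<bar> < \<bar>q * v + (1 - q) * - p - c\<bar>" for v
      using p(3)[of "- v"] that flip[of v A] flip[of v "- p"] by (simp add: abs_minus_commute)
  qed
qed

text \<open>If \<open>v\<close> lay beyond \<open>p\<close> as seen from \<open>c\<close>, the
  weighted mean of \<open>v\<close> and \<open>p\<close> would be strictly closer to
  \<open>c\<close> than \<open>v\<close> is.\<close>

lemma prefers_side:
  fixes q c p v :: real
  assumes "0 \<le> q" "q < 1" "\<bar>v - c\<bar> \<le> \<bar>q * v + (1 - q) * p - c\<bar>"
  shows "c \<le> p \<Longrightarrow> v \<le> p" and "p \<le> c \<Longrightarrow> p \<le> v"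
proof -
  define e where "e = (1 - q) * (p - c)"
  have 0: "q * v + (1 - q) * p - c = q * (v - c) + e"
    by (simp add: e_def algebra_simps)
  have 1: "p < v \<longleftrightarrow> e < (1 - q) * (v - c)" "v < p \<longleftrightarrow> (1 - q) * (v - c) < e"
    using assms by (simp_all add: e_def)
  have 2: "0 \<le> e" if "c \<le> p"
    using assms that by (simp add: e_def)
  have 3: "e \<le> 0" if "p \<le> c"
    using assms that by (simp add: e_def mult_nonneg_nonpos)
  have 4: "0 \<le> q * (v - c)" if "v - c \<ge> 0" using that assms by simp
  have 5: "q * (v - c) \<le> 0" if "v - c \<le> 0"
    using that assms by (simp add: mult_nonneg_nonpos)
  show "v \<le> p" if "c \<le> p"
  proof (rule ccontr)
    assume "\<not> v \<le> p"
    then show False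
      using assms(3) 1(1) 2[OF that] 4 that unfolding 0 by (auto simp: algebra_simps)
  qed
  show "p \<le> v" if "p \<le> c"
  proof (rule ccontr)
    assume "\<not> p \<le> v"
    then show False
      using assms(3) 1(2) 3[OF that] 5 that unfolding 0 by (auto simp: algebra_simps)
  qed
qed

lemma indifferent_at_prior_price:
  fixes q c v :: real
  assumes "0 \<le> q" "q < 1" "\<bar>v - c\<bar> \<le> \<bar>q * v + (1 - q) * c - c\<bar>"
  shows "v = c"
  using prefers_side[OF assms] by simp

lemma integral_signed_zero:
  fixes h :: "'a \<Rightarrow> real"
  assumes "integrable M h" "integral\<^sup>L M h = 0" "(\<forall>x. 0 \<le> h x) \<or> (\<forall>x. h x \<le> 0)"
  shows "AE x in M. h x = 0"
  using assms(3)
proof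
  assume "\<forall>x. 0 \<le> h x"
  then show ?thesis using assms(1,2) integral_nonneg_eq_0_iff_AE[of M h] by auto
next
  assume "\<forall>x. h x \<le> 0"
  then show ?thesis using assms(1,2) integral_nonneg_eq_0_iff_AE[of M "\<lambda>x. - h x"] by auto
qed

section \<open>Conditional values in the game\<close>

context disclosure_game
begin

abbreviation "law_r \<equiv> density lborel f"
abbreviation "law_x \<equiv> density lborel g"

lemmas law_r_facts = density_facts[OF f_density f_mean]
lemmas law_x_facts = density_facts[OF g_density g_mean]

lemma law_eqs:
  "law Uninformed = state_law law_r law_x \<alpha> \<beta>"
  "law (Partial r) = state_law (return borel r) law_x 1 \<beta>"
  "law (Informed r x) = state_law (return borel r) (return borel x) 1 1"
  by (simp_all add: return_pmf_True_bernoulli)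

lemma probabilities: "\<alpha> \<in> {0..1}" "\<beta> \<in> {0..1}" "(1::real) \<in> {0..1}"
  using alpha beta by auto

text \<open>For measurable preimages this is affine in \<open>p\<close> with slope minus the
  probability of \<open>S\<close>. Its zero is therefore the conditional value whenever that
  probability is positive, and the probability itself is the drop from \<open>p = 0\<close> to
  \<open>p = 1\<close>; one integral formula serves for both.\<close>

definition gap :: "inv_type \<Rightarrow> inv_type set \<Rightarrow> real \<Rightarrow> real" where
  "gap m S p = (\<integral>s. indicator (type_in -` S) s * (firm_value s - p) \<partial>law m)"

lemma gap_eq:
  assumes "type_in -` S \<in> sets (law m)"
  shows "gap m S p = (LINT s : type_in -` S | law m. firm_value s) - p * type_prob m S"
proof (cases m)
  case Uninformed
  show ?thesis
    using assms unfolding gap_def type_prob_def Uninformed law_eqs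
    by (intro state_law_gap law_r_facts(1,2) law_x_facts(1,2) return_borel(1-3) probabilities)
      (simp_all only: sets_density sets_lborel)
next
  case (Partial r)
  show ?thesis
    using assms unfolding gap_def type_prob_def Partial law_eqs
    by (intro state_law_gap law_r_facts(1,2) law_x_facts(1,2) return_borel(1-3) probabilities)
      (simp_all only: sets_density sets_lborel)
next
  case (Informed r x)
  show ?thesis
    using assms unfolding gap_def type_prob_def Informed law_eqs
    by (intro state_law_gap law_r_facts(1,2) law_x_facts(1,2) return_borel(1-3) probabilities)
qed

lemma type_prob_gap:
  assumes "type_in -` S \<in> sets (law m)"
  shows "type_prob m S = gap m S 0 - gap m S 1"
  using gap_eq[OF assms] by simp

lemma cond_value_eq_iff:
  assumes "type_in -` S \<in> sets (law m)" "0 < type_prob m S"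
  shows "cond_value m S = p \<longleftrightarrow> gap m S p = 0"
  using gap_eq[OF assms(1), of p] assms(2) by (auto simp: cond_value_def field_simps)

lemma gap_Uninformed:
  assumes "type_in -` S \<in> sets (law Uninformed)"
  defines "F \<equiv> \<lambda>p r. (1 - \<alpha>) * indicator S Uninformed * (r * \<mu>0 - p) +
      \<alpha> * ((1 - \<beta>) * indicator S (Partial r) * (r * \<mu>0 - p) +
        \<beta> * (\<integral>x. indicator S (Informed r x) * (r * x - p) \<partial>law_x))"
  shows "gap Uninformed S p = (\<integral>r. F p r \<partial>law_r)" "integrable law_r (F p)"
proof -
  have *: "prob_space law_r" "sets law_r = sets borel" "integrable law_r (\<lambda>r. r)"
    "prob_space law_x" "sets law_x = sets borel" "integrable law_x (\<lambda>r. r)"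
    "\<alpha> \<in> {0..1}" "\<beta> \<in> {0..1}" "type_in -` S \<in> sets (state_law law_r law_x \<alpha> \<beta>)"
    using assms(1) probabilities law_r_facts law_x_facts by (auto simp only: law_eqs sets_density sets_lborel)
  show "gap Uninformed S p = (\<integral>r. F p r \<partial>law_r)"
    using state_law_integral(2)[OF *] unfolding gap_def law_eqs F_def law_x_facts(3) .
  show "integrable law_r (F p)"
    using state_law_integral(3)[OF *] unfolding F_def law_x_facts(3) .
qed

lemma gap_Partial:
  assumes "type_in -` S \<in> sets (law (Partial r))"
  shows "gap (Partial r) S p = (1 - \<beta>) * indicator S (Partial r) * (r * \<mu>0 - p) +
      \<beta> * (\<integral>x. indicator S (Informed r x) * (r * x - p) \<partial>law_x)"
proof -
  have *: "prob_space (return borel r)" "sets (return borel r) = sets borel" "integrable (return borel r) (\<lambda>r. r)"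
    "prob_space law_x" "sets law_x = sets borel" "integrable law_x (\<lambda>r. r)"
    "(1::real) \<in> {0..1}" "\<beta> \<in> {0..1}" "type_in -` S \<in> sets (state_law (return borel r) law_x 1 \<beta>)"
    using assms(1) probabilities return_borel law_x_facts by (auto simp only: law_eqs sets_density sets_lborel)
  show ?thesis
    using state_law_integral(2)[OF *] borel_measurable_integrable[OF state_law_integral(3)[OF *]]
    unfolding gap_def law_eqs law_x_facts(3) by (simp add: integral_return)
qed

lemma gap_Informed:
  assumes "type_in -` S \<in> sets (law (Informed r x))"
  shows "gap (Informed r x) S p = indicator S (Informed r x) * (r * x - p)"
proof -
  have *: "prob_space (return borel r)" "sets (return borel r) = sets borel" "integrable (return borel r) (\<lambda>r. r)"
    "prob_space (return borel x)" "sets (return borel x) = sets borel" "integrable (return borel x) (\<lambda>r. r)"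
    "(1::real) \<in> {0..1}" "(1::real) \<in> {0..1}" "type_in -` S \<in> sets (state_law (return borel r) (return borel x) 1 1)"
    using assms(1) probabilities return_borel by (auto simp only: law_eqs)
  have "{x. Informed r x \<in> S} \<in> sets borel"
    using type_in_vimage_measurable[OF *(9,2,5)] .
  then have "(\<lambda>x. indicator {x. Informed r x \<in> S} x * (r * x - p)) \<in> borel_measurable borel"
    by measurable
  then have m: "(\<lambda>x. indicator S (Informed r x) * (r * x - p)) \<in> borel_measurable borel"
    by (simp add: indicator_def)
  show ?thesis
    using state_law_integral(2)[OF *] borel_measurable_integrable[OF state_law_integral(3)[OF *]] m
    unfolding gap_def law_eqs by (simp add: integral_return)
qed

lemma vimage_sets:
  "X \<in> sets borel \<Longrightarrow> type_in -` ({Partial r} \<union> Informed r ` X) \<in> sets (law (Partial r))"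
  "type_in -` {Uninformed} \<in> sets (law Uninformed)"
  "type_in -` {Informed r x} \<in> sets (law (Informed r x))"
  unfolding law_eqs
  by (rule type_in_vimage_sets(3); simp)
    (rule type_in_vimage_sets(1)[where X = UNIV] type_in_vimage_sets(2)[where X = UNIV]; simp)+

lemma informed_section:
  "type_in -` S \<in> sets (law Uninformed) \<Longrightarrow> {x. Informed r x \<in> S} \<in> sets borel"
  "type_in -` S \<in> sets (law (Partial r)) \<Longrightarrow> {x. Informed r x \<in> S} \<in> sets borel"
  unfolding law_eqs by (rule type_in_vimage_measurable; simp)+

lemma integrable_section:
  assumes "{x. Informed r x \<in> S} \<in> sets borel"
  shows "integrable law_x (\<lambda>x. indicator S (Informed r x) * (r * x - p))"
proof -
  interpret prob_space law_x by (rule law_x_facts)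
  have "integrable law_x (\<lambda>x. r * x - p)"
    using law_x_facts(2) by auto
  with assms have "integrable law_x (\<lambda>x. indicator {x. Informed r x \<in> S} x *\<^sub>R (r * x - p))"
    by (intro integrable_mult_indicator) auto
  then show ?thesis
    by (rule back_subst[of "integrable _"]) (auto simp: indicator_def)
qed

lemma AE_value_neq: "0 < r \<Longrightarrow> AE x in law_x. r * x \<noteq> c"
  using law_x_facts(4)[of "c / r"] by eventually_elim auto

lemma mem_type_space [simp]:
  "Uninformed \<in> type_space" "Partial r \<in> type_space \<longleftrightarrow> 0 < r" "Informed r x \<in> type_space \<longleftrightarrow> 0 < r"
  by (auto simp: type_space_def)

section \<open>Optimal positions\<close>

lemma profit_le: "\<rho>' \<in> {-1..1} \<Longrightarrow> profit t \<rho>' p \<le> \<bar>q * own_value t + (1 - q) * p - P1\<bar>"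
proof -
  let ?w = "q * own_value t + (1 - q) * p - P1"
  assume "\<rho>' \<in> {-1..1}"
  then have "\<bar>\<rho>'\<bar> * \<bar>?w\<bar> \<le> 1 * \<bar>?w\<bar>"
    by (intro mult_right_mono) auto
  then show ?thesis
    using abs_ge_self[of "\<rho>' * ?w"] by (simp add: profit_def abs_mult)
qed

lemma profit_attained:
  obtains \<rho>' where "\<rho>' \<in> {-1..1}" "profit t \<rho>' p = \<bar>q * own_value t + (1 - q) * p - P1\<bar>"
  \<comment> \<open>The best position is the sign of the expected price change.\<close>
  using that[of "sgn (q * own_value t + (1 - q) * p - P1)"]
  by (auto simp: profit_def sgn_if mult.commute)

lemma benefits_iff:
  "benefits \<rho> d P2 t m p \<longleftrightarrow>
     m \<in> msgs t \<and> profit t (\<rho> t) (P2 (d t)) < \<bar>q * own_value t + (1 - q) * p - P1\<bar>"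
proof
  assume "benefits \<rho> d P2 t m p"
  then obtain \<rho>' where "m \<in> msgs t" "\<rho>' \<in> {-1..1}" "profit t (\<rho> t) (P2 (d t)) < profit t \<rho>' p"
    by (auto simp: benefits_def)
  then show "m \<in> msgs t \<and> profit t (\<rho> t) (P2 (d t)) < \<bar>q * own_value t + (1 - q) * p - P1\<bar>"
    using profit_le[of \<rho>' t p] by simp
next
  assume *: "m \<in> msgs t \<and> profit t (\<rho> t) (P2 (d t)) < \<bar>q * own_value t + (1 - q) * p - P1\<bar>"
  obtain \<rho>' where "\<rho>' \<in> {-1..1}" "profit t \<rho>' p = \<bar>q * own_value t + (1 - q) * p - P1\<bar>"
    by (rule profit_attained)
  with * show "benefits \<rho> d P2 t m p"
    unfolding benefits_def by (metis (no_types))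
qed

declare law.simps [simp del]

section \<open>Bounds on equilibrium utility\<close>

context
  fixes \<rho> d P2
  assumes eq: "GPFE \<rho> d P2"
begin

abbreviation "utility t \<equiv> profit t (\<rho> t) (P2 (d t))"
abbreviation "gain v p \<equiv> \<bar>q * v + (1 - q) * p - P1\<bar>"

lemma eq_pbe: "PBE \<rho> d P2"
  using eq by (simp add: GPFE_def)

lemma eq_strategy: "strategy \<rho> d"
  using eq_pbe by (simp add: PBE_def)

lemma d_msgs: "t \<in> type_space \<Longrightarrow> d t \<in> msgs t"
  using eq_strategy by (simp add: strategy_def)

lemma sender_sets: "m \<in> type_space \<Longrightarrow> type_in -` sender_types d m \<in> sets (law m)"
  using eq_strategy by (simp add: strategy_def)

lemma mem_sender [simp]: "t \<in> sender_types d m \<longleftrightarrow> t \<in> type_space \<and> d t = m"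
  by (simp add: sender_types_def)

lemma price_on_path:
  assumes "m \<in> type_space" "0 < type_prob m (sender_types d m)"
  shows "gap m (sender_types d m) (P2 m) = 0"
proof -
  have "P2 m = cond_value m (sender_types d m)"
    using eq_pbe assms by (simp add: PBE_def on_path_def)
  then show ?thesis
    using cond_value_eq_iff[OF sender_sets[OF assms(1)] assms(2)] by metis
qed

lemma not_self_signaling: "\<not> self_signaling \<rho> d P2 S"
  using eq by (auto simp: GPFE_def)

lemma utility_ge:
  assumes "t \<in> type_space" "m \<in> msgs t"
  shows "gain (own_value t) (P2 m) \<le> utility t"
proof -
  obtain \<rho>' where "\<rho>' \<in> {-1..1}" "profit t \<rho>' (P2 m) = gain (own_value t) (P2 m)"
    by (rule profit_attained)
  then show ?thesis
    using eq_pbe assms unfolding PBE_def by metis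
qed

lemma utility_eq:
  assumes "t \<in> type_space"
  shows "utility t = gain (own_value t) (P2 (d t))"
proof (rule antisym)
  have "\<rho> t \<in> {-1..1}"
    using eq_strategy assms by (simp add: strategy_def)
  then show "utility t \<le> gain (own_value t) (P2 (d t))"
    by (rule profit_le)
qed (rule utility_ge[OF assms d_msgs[OF assms]])

text \<open>Taking \<open>S\<close> to consist of all types that benefit at the price
  \<open>p\<close> makes both incentive conditions automatic; only the consistency of
  \<open>p\<close> with \<open>S\<close> remains to be checked.\<close>

lemma self_signalingI:
  assumes "m \<in> type_space" "\<not> on_path d m" "S = {t \<in> type_space. benefits \<rho> d P2 t m p}"
    and "type_in -` S \<in> sets (law m)" "0 < type_prob m S" "gap m S p = 0"
  shows "self_signaling \<rho> d P2 S"
proof -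
  have "cond_value m S = p"
    using cond_value_eq_iff assms(4-6) by blast
  moreover have "S \<noteq> {}"
    using assms(5) by (auto simp: type_prob_def)
  ultimately show ?thesis
    using assms(1,2,3,5) unfolding self_signaling_def by auto
qed

lemma price_Informed:
  assumes "0 < r" "d (Informed r x) = Informed r x"
  shows "P2 (Informed r x) = r * x"
proof -
  let ?m = "Informed r x"
  have S: "type_in -` sender_types d ?m \<in> sets (law ?m)"
    using sender_sets assms by simp
  have "0 < type_prob ?m (sender_types d ?m)"
    unfolding type_prob_gap[OF S] gap_Informed[OF S] using assms by simp
  from price_on_path[OF _ this] show ?thesis
    unfolding gap_Informed[OF S] using assms by simp
qed

text \<open>If the type reveals itself, its price is \<open>r * x\<close>. If not, the message is
  off path, and earning less would make the singleton of this type self-signaling.\<close>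

lemma utility_Informed_ge:
  assumes r: "0 < r"
  shows "\<bar>r * x - P1\<bar> \<le> utility (Informed r x)"
proof (rule ccontr)
  let ?m = "Informed r x"
  assume "\<not> ?thesis"
  \<comment> \<open>At a price equal to the own value, revelation of the value by other sources
    changes nothing, so the gain is \<open>\<bar>r * x - P1\<bar>\<close>.\<close>
  then have less: "utility ?m < gain (r * x) (r * x)"
    by (simp add: algebra_simps)
  show False
  proof (cases "d ?m = ?m")
    case True
    with less r show False
      using utility_eq[of ?m] price_Informed[OF r True] by simp
  next
    case False
    have S: "type_in -` sender_types d ?m \<in> sets (law ?m)"
      using sender_sets r by simp
    have "\<not> on_path d ?m"
      unfolding on_path_def type_prob_gap[OF S] gap_Informed[OF S] using False by simp
    moreover have "{t \<in> type_space. benefits \<rho> d P2 t ?m (r * x)} = {?m}"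
    proof -
      have "t = ?m" if "?m \<in> msgs t" for t
        using that by (cases t) auto
      then show ?thesis
        using less r by (auto simp: benefits_iff)
    qed
    ultimately have "self_signaling \<rho> d P2 {?m}"
      using vimage_sets(3)[of r x] r
      by (intro self_signalingI[where m = ?m and p = "r * x"])
        (simp_all add: type_prob_gap gap_Informed)
    with not_self_signaling show False by blast
  qed
qed

lemma d_Informed_cases:
  assumes "0 < r"
  obtains "d (Informed r x) = Informed r x" | "d (Informed r x) = Partial r" | "d (Informed r x) = Uninformed"
  using d_msgs[of "Informed r x"] assms by auto

lemma d_Partial_cases:
  assumes "0 < r"
  obtains "d (Partial r) = Partial r" | "d (Partial r) = Uninformed"
  using d_msgs[of "Partial r"] assms by auto

lemma pooled_prefers:
  assumes "0 < r" "d (Informed r x) = m"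
  shows "\<bar>r * x - P1\<bar> \<le> gain (r * x) (P2 m)"
  using utility_Informed_ge[of r x] utility_eq[of "Informed r x"] assms by simp

lemmas pooled_side = prefers_side[OF q pooled_prefers]

section \<open>The message \<open>Partial r\<close> when the partially informed type hides\<close>

lemma integral_section_nonneg: "0 \<le> (\<integral>x. indicator S (Informed r x) \<partial>law_x :: real)"
  by (intro Bochner_Integration.integral_nonneg) auto

lemma type_prob_Partial:
  assumes "type_in -` S \<in> sets (law (Partial r))"
  shows "type_prob (Partial r) S =
    (1 - \<beta>) * indicator S (Partial r) + \<beta> * (\<integral>x. indicator S (Informed r x) \<partial>law_x)"
proof -
  note I = integrable_section[OF informed_section(2)[OF assms]]
  have 0: "(\<integral>x. indicator S (Informed r x) * (r * x - 0) \<partial>law_x) -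
      (\<integral>x. indicator S (Informed r x) * (r * x - 1) \<partial>law_x) = (\<integral>x. indicator S (Informed r x) \<partial>law_x)"
    by (subst Bochner_Integration.integral_diff[OF I I, symmetric])
      (intro Bochner_Integration.integral_cong, auto simp: algebra_simps)
  show ?thesis
    unfolding type_prob_gap[OF assms] gap_Partial[OF assms] 0[symmetric] by (simp add: algebra_simps)
qed

text \<open>Informed types sending \<open>Partial r\<close> have values on one side of its price; were they the only
  senders, that price would be the mean of their values, so they would form a null set.\<close>

lemma Partial_off_path:
  assumes r: "0 < r" and d: "d (Partial r) = Uninformed"
  shows "\<not> on_path d (Partial r)" and "\<beta> \<noteq> 0 \<Longrightarrow> AE x in law_x. d (Informed r x) \<noteq> Partial r"
proof -
  let ?S = "sender_types d (Partial r)"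
  let ?p = "P2 (Partial r)"
  interpret prob_space law_x by (rule law_x_facts)
  have S: "type_in -` ?S \<in> sets (law (Partial r))"
    using sender_sets r by simp
  have P: "type_prob (Partial r) ?S = \<beta> * (\<integral>x. indicator ?S (Informed r x) \<partial>law_x)"
    unfolding type_prob_Partial[OF S] using d by simp
  have null: "(\<integral>x. indicator ?S (Informed r x) \<partial>law_x) = (0 :: real)"
    if "on_path d (Partial r)"
  proof -
    have *: "0 < type_prob (Partial r) ?S"
      using that by (simp add: on_path_def)
    then have "\<beta> \<noteq> 0" using P by auto
    moreover have "gap (Partial r) ?S ?p = 0"
      using price_on_path[OF _ *] r by simp
    ultimately have "(\<integral>x. indicator ?S (Informed r x) * (r * x - ?p) \<partial>law_x) = 0"
      unfolding gap_Partial[OF S] using d by simp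
    moreover have "(\<forall>x. 0 \<le> indicator ?S (Informed r x) * (r * x - ?p)) \<or>
        (\<forall>x. indicator ?S (Informed r x) * (r * x - ?p) \<le> 0)"
      using pooled_side[where r = r and m = "Partial r", OF r] by (cases "P1 \<le> ?p") (auto simp: indicator_def)
    ultimately have "AE x in law_x. indicator ?S (Informed r x) * (r * x - ?p) = 0"
      by (intro integral_signed_zero integrable_section informed_section(2)[OF S])
    then have "AE x in law_x. indicator ?S (Informed r x) = (0 :: real)"
      using AE_value_neq[OF r, of ?p] by eventually_elim auto
    then show ?thesis
      by (rule integral_eq_zero_AE)
  qed
  then show off: "\<not> on_path d (Partial r)"
    using P by (auto simp: on_path_def)
  show "AE x in law_x. d (Informed r x) \<noteq> Partial r" if "\<beta> \<noteq> 0"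
  proof -
    have X: "{x. Informed r x \<in> ?S} \<in> sets law_x"
      using informed_section(2)[OF S] by (simp only: sets_density sets_lborel)
    have "integrable law_x (indicator {x. Informed r x \<in> ?S} :: real \<Rightarrow> real)"
      by (rule integrable_real_indicator[OF X]) (simp add: less_top[symmetric])
    then have "integrable law_x (\<lambda>x. indicator ?S (Informed r x) :: real)"
      by (rule back_subst[of "integrable _"]) (auto simp: indicator_def)
    moreover have "(\<integral>x. indicator ?S (Informed r x) \<partial>law_x) = (0 :: real)"
      using off that beta integral_section_nonneg[of ?S r] P
      by (auto simp: on_path_def zero_less_mult_iff)
    ultimately have "AE x in law_x. indicator ?S (Informed r x) = (0 :: real)"
      by (intro integral_signed_zero) auto
    then show ?thesis
      by eventually_elim (use r in \<open>auto simp: indicator_def split: if_splits\<close>)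
  qed
qed

text \<open>The position \<open>\<rho>\<close> may be non-measurable, but utility is the optimal
  gain at the price of the message sent, so it is measurable piecewise on the regions where
  \<open>d\<close> sends each kind of message.\<close>

lemma utility_measurable:
  assumes r: "0 < r"
  shows "(\<lambda>x. utility (Informed r x)) \<in> borel_measurable borel"
proof -
  have m [measurable]: "{x. d (Informed r x) = Uninformed} \<in> sets borel"
    "{x. d (Informed r x) = Partial r} \<in> sets borel"
    using informed_section(1)[OF sender_sets[of Uninformed], of r]
      informed_section(2)[OF sender_sets[of "Partial r"]] r by simp_all
  have "utility (Informed r x) =
      (if x \<in> {x. d (Informed r x) = Uninformed} then gain (r * x) (P2 Uninformed)
       else if x \<in> {x. d (Informed r x) = Partial r} then gain (r * x) (P2 (Partial r))
       else gain (r * x) (r * x))" for x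
    using utility_eq[of "Informed r x"] r price_Informed[OF r, of x]
    by (cases rule: d_Informed_cases[OF r, of x]) auto
  then show ?thesis
    by (simp only:) measurable
qed

lemma value_integrable: "integrable law_x (\<lambda>x. r * x)"
  using law_x_facts(2) by auto

text \<open>A type \<open>Partial r\<close> hiding \<open>r\<close> cannot pull the price of the pool towards its own value: otherwise
  some price of \<open>Partial r\<close> is the mean value of the types that benefit from it.\<close>

lemma no_pool_gap:
  assumes r: "0 < r" and d: "d (Partial r) = Uninformed"
  defines "J \<equiv> pool_gap law_x (\<lambda>x. r * x) (r * \<mu>0) \<beta> q P1 (P2 Uninformed)"
  shows "P1 \<le> P2 Uninformed \<Longrightarrow> J \<le> 0" and "P2 Uninformed \<le> P1 \<Longrightarrow> 0 \<le> J"
proof -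
  let ?A = "P2 Uninformed"
  have "\<not> (P1 \<le> ?A \<and> 0 < J \<or> ?A \<le> P1 \<and> J < 0)"
  proof
    assume "P1 \<le> ?A \<and> 0 < J \<or> ?A \<le> P1 \<and> J < 0"
    then obtain p where p: "pool_gap law_x (\<lambda>x. r * x) (r * \<mu>0) \<beta> q P1 p = 0"
      "gain (r * \<mu>0) ?A < gain (r * \<mu>0) p"
      "\<And>v. \<bar>v - P1\<bar> < gain v p \<Longrightarrow> gain v ?A < gain v p"
      using pool_gap_fixpoint[OF law_x_facts(1) value_integrable AE_value_neq[OF r] beta q, of P1 ?A "r * \<mu>0"]
      unfolding J_def by blast
    \<comment> \<open>\<open>S\<close> collects every type that gains from \<open>Partial r\<close>
      at the price \<open>p\<close>: the partially informed type by the second property of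
      \<open>p\<close>, and the informed types with \<open>x\<close> in \<open>X\<close>.\<close>
    define X where "X = {x. utility (Informed r x) < gain (r * x) p}"
    define S where "S = {Partial r} \<union> Informed r ` X"
    have "X \<in> sets borel"
      unfolding X_def using utility_measurable[OF r] by measurable
    from vimage_sets(1)[OF this] have S: "type_in -` S \<in> sets (law (Partial r))"
      unfolding S_def .
    have ind: "indicator S (Partial r) = (1 :: real)" "indicator S (Informed r x) = (indicator X x :: real)" for x
      by (auto simp: S_def indicator_def)
    have "S = {t \<in> type_space. benefits \<rho> d P2 t (Partial r) p}"
    proof -
      have "Partial r \<in> msgs t \<longleftrightarrow> t = Partial r \<or> (\<exists>x. t = Informed r x)" for t
        by (cases t) auto
      moreover have "utility (Partial r) < gain (r * \<mu>0) p"
        using p(2) utility_eq[of "Partial r"] r d by simp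
      ultimately show ?thesis
        using r by (auto simp: S_def X_def benefits_iff)
    qed
    moreover have "0 < type_prob (Partial r) S"
      unfolding type_prob_Partial[OF S] using ind(1) beta integral_section_nonneg[of S r]
      by (simp add: add_pos_nonneg)
    moreover have "gap (Partial r) S p = 0"
    proof -
      \<comment> \<open>Almost every informed type reveals \<open>x\<close> or hides, so it earns
        \<open>\<bar>r * x - P1\<bar>\<close> or the gain at the non-disclosure price. By the third
        property of \<open>p\<close>, preferring \<open>p\<close> to revelation implies preferring
        it to hiding, hence \<open>X\<close> agrees almost everywhere with the set in
        \<open>pool_gap\<close>.\<close>
      have "(\<integral>x. indicator X x * (r * x - p) \<partial>law_x) =
          (\<integral>x. indicator {v. \<bar>v - P1\<bar> < gain v p} (r * x) * (r * x - p) \<partial>law_x)" if "\<beta> \<noteq> 0"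
      proof (rule integral_cong_AE)
        show "AE x in law_x. indicator X x * (r * x - p) =
            indicator {v. \<bar>v - P1\<bar> < gain v p} (r * x) * (r * x - p)"
          using Partial_off_path(2)[OF r d that]
        proof eventually_elim
          case (elim x)
          have u: "utility (Informed r x) = \<bar>r * x - P1\<bar> \<or> utility (Informed r x) = gain (r * x) ?A"
            using elim utility_eq[of "Informed r x"] r price_Informed[OF r, of x]
            by (cases rule: d_Informed_cases[OF r, of x]) (auto simp: algebra_simps)
          have "x \<in> X \<longleftrightarrow> \<bar>r * x - P1\<bar> < gain (r * x) p"
          proof
            assume "x \<in> X"
            then show "\<bar>r * x - P1\<bar> < gain (r * x) p"
              using utility_Informed_ge[OF r, of x] by (simp add: X_def)
          next
            assume "\<bar>r * x - P1\<bar> < gain (r * x) p"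
            with p(3)[OF this] u show "x \<in> X"
              unfolding X_def by auto
          qed
          then show ?case
            by (simp add: indicator_def)
        qed
      qed (use \<open>X \<in> sets borel\<close> in measurable)
      then show ?thesis
        using p(1) unfolding gap_Partial[OF S] ind pool_gap_def by (cases "\<beta> = 0") simp_all
    qed
    ultimately have "self_signaling \<rho> d P2 S"
      using S Partial_off_path(1)[OF r d] r by (intro self_signalingI[where m = "Partial r"]) auto
    with not_self_signaling show False by blast
  qed
  then show "P1 \<le> ?A \<Longrightarrow> J \<le> 0" "?A \<le> P1 \<Longrightarrow> 0 \<le> J"
    by auto
qed

section \<open>The price of non-disclosure\<close>

text \<open>Equality of the two absolute values holds for at most two values, \<open>p\<close> and
  the lower endpoint from \<open>prefers_iff\<close>.\<close>

lemma AE_not_indifferent: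
  assumes "0 < r"
  shows "AE x in law_x. \<bar>r * x - P1\<bar> \<noteq> gain (r * x) p"
  using AE_value_neq[OF assms, of p] AE_value_neq[OF assms, of "(2 * P1 - (1 - q) * p) / (1 + q)"]
proof eventually_elim
  case (elim x)
  have "(1 + q) * (r * x) \<noteq> 2 * P1 - (1 - q) * p"
    using elim(2) q by (simp add: field_simps)
  moreover have "(1 - q) * (r * x - p) \<noteq> 0"
    using elim(1) q by simp
  ultimately show ?case
    by (auto simp: abs_if algebra_simps)
qed

text \<open>\<open>K\<close> is the contribution to the gap of the non-disclosure pool of the types
  that know \<open>r\<close>. If \<open>Partial r\<close> discloses, only informed types contribute
  and \<open>pooled_side\<close> fixes their sign; if it hides, \<open>K\<close> is the
  \<open>pool_gap\<close> bounded by \<open>no_pool_gap\<close>.\<close>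

lemma pool_contribution:
  assumes r: "0 < r"
  defines "K \<equiv> (1 - \<beta>) * indicator (sender_types d Uninformed) (Partial r) * (r * \<mu>0 - P2 Uninformed) +
    \<beta> * (\<integral>x. indicator (sender_types d Uninformed) (Informed r x) * (r * x - P2 Uninformed) \<partial>law_x)"
  shows "P1 \<le> P2 Uninformed \<Longrightarrow> K \<le> 0" and "P2 Uninformed \<le> P1 \<Longrightarrow> 0 \<le> K"
proof -
  let ?S = "sender_types d Uninformed" and ?A = "P2 Uninformed"
  have "(P1 \<le> ?A \<longrightarrow> K \<le> 0) \<and> (?A \<le> P1 \<longrightarrow> 0 \<le> K)"
  proof (cases rule: d_Partial_cases[OF r])
    case 1
    have "(\<integral>x. indicator ?S (Informed r x) * (r * x - ?A) \<partial>law_x) \<le> 0" if "P1 \<le> ?A"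
      using pooled_side(1)[where r = r and m = Uninformed, OF r] that by (intro integral_nonpos) (auto simp: indicator_def)
    moreover have "0 \<le> (\<integral>x. indicator ?S (Informed r x) * (r * x - ?A) \<partial>law_x)" if "?A \<le> P1"
      using pooled_side(2)[where r = r and m = Uninformed, OF r] that by (intro Bochner_Integration.integral_nonneg) (auto simp: indicator_def)
    ultimately show ?thesis
      using 1 beta(1) by (simp add: K_def mult_nonneg_nonpos)
  next
    case 2
    have "(\<integral>x. indicator ?S (Informed r x) * (r * x - ?A) \<partial>law_x) =
        (\<integral>x. indicator {v. \<bar>v - P1\<bar> < gain v ?A} (r * x) * (r * x - ?A) \<partial>law_x)" if "\<beta> \<noteq> 0"
    proof (rule integral_cong_AE)
      show "(\<lambda>x. indicator ?S (Informed r x) * (r * x - ?A)) \<in> borel_measurable law_x"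
        using integrable_section[OF informed_section(1)[OF sender_sets]] by (intro borel_measurable_integrable) simp
      show "AE x in law_x. indicator ?S (Informed r x) * (r * x - ?A) =
          indicator {v. \<bar>v - P1\<bar> < gain v ?A} (r * x) * (r * x - ?A)"
        using Partial_off_path(2)[OF r 2 that] AE_not_indifferent[OF r, of ?A]
      proof eventually_elim
        case (elim x)
        have "d (Informed r x) = Uninformed \<longleftrightarrow> \<bar>r * x - P1\<bar> < gain (r * x) ?A"
        proof
          assume "d (Informed r x) = Uninformed"
          from pooled_prefers[OF r this] elim(2) show "\<bar>r * x - P1\<bar> < gain (r * x) ?A" by simp
        next
          assume *: "\<bar>r * x - P1\<bar> < gain (r * x) ?A"
          have "gain (r * x) ?A \<le> utility (Informed r x)"
            using utility_ge[of "Informed r x" Uninformed] r by simp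
          with * elim(1) show "d (Informed r x) = Uninformed"
            using utility_eq[of "Informed r x"] r price_Informed[OF r, of x]
            by (cases rule: d_Informed_cases[OF r, of x]) (auto simp: algebra_simps)
        qed
        with r show ?case
          by (simp add: indicator_def)
      qed
    qed measurable
    then have "K = pool_gap law_x (\<lambda>x. r * x) (r * \<mu>0) \<beta> q P1 ?A"
      using 2 r by (auto simp: K_def pool_gap_def)
    then show ?thesis
      using no_pool_gap[OF r 2] by simp
  qed
  then show "P1 \<le> ?A \<Longrightarrow> K \<le> 0" "?A \<le> P1 \<Longrightarrow> 0 \<le> K"
    by auto
qed

text \<open>The pool's gap at its own price is zero and splits into a term of the uninformed,
  \<open>(1 - \<alpha>) * (P1 - P2 Uninformed)\<close>, and the integral of
  \<open>\<alpha> * K r\<close>. For a price other than \<open>P1\<close> the first is nonzero and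
  the second has weakly the same sign.\<close>

lemma price_Uninformed: "P2 Uninformed = P1"
proof -
  let ?S = "sender_types d Uninformed" and ?A = "P2 Uninformed"
  define K where "K r = (1 - \<beta>) * indicator ?S (Partial r) * (r * \<mu>0 - ?A) +
    \<beta> * (\<integral>x. indicator ?S (Informed r x) * (r * x - ?A) \<partial>law_x)" for r
  interpret R: prob_space law_r by (rule law_r_facts)
  interpret L: prob_space "law Uninformed"
    unfolding law_eqs by (intro prob_space_state_law law_r_facts law_x_facts)
  have S: "type_in -` ?S \<in> sets (law Uninformed)"
    using sender_sets by simp
  have U: "Uninformed \<in> ?S"
    using d_msgs[of Uninformed] by simp
  have rint: "integrable law_r (\<lambda>r. r * \<mu>0 - p)" "(\<integral>r. r * \<mu>0 - p \<partial>law_r) = P1 - p" for p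
    using law_r_facts(2,3) R.prob_space by (auto simp: P1_def)
  have "gap Uninformed {Uninformed} p = (1 - \<alpha>) * (P1 - p)" for p
    unfolding gap_Uninformed(1)[OF vimage_sets(2)] using rint(2)[of p] by simp
  then have "type_prob Uninformed {Uninformed} = 1 - \<alpha>"
    unfolding type_prob_gap[OF vimage_sets(2)] by (simp only:) (simp add: algebra_simps)
  \<comment> \<open>The uninformed can only stay silent, so silence has probability at least 1 -
    \<alpha> > 0 and its price is a conditional value.\<close>
  moreover have "type_prob Uninformed {Uninformed} \<le> type_prob Uninformed ?S"
    unfolding type_prob_def using U by (intro L.finite_measure_mono[OF vimage_mono S] insert_subsetI empty_subsetI)
  ultimately have "0 < type_prob Uninformed ?S"
    using alpha by simp
  from price_on_path[OF _ this] have "(\<integral>r. (1 - \<alpha>) * (r * \<mu>0 - ?A) + \<alpha> * K r \<partial>law_r) = 0"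
    unfolding gap_Uninformed(1)[OF S] using U by (simp add: K_def)
  moreover have *: "integrable law_r (\<lambda>r. (1 - \<alpha>) * (r * \<mu>0 - ?A))"
    by (rule integrable_mult_right[OF rint(1)])
  moreover have "integrable law_r (\<lambda>r. \<alpha> * K r)"
  proof -
    have "integrable law_r (\<lambda>r. (1 - \<alpha>) * (r * \<mu>0 - ?A) + \<alpha> * K r)"
      using gap_Uninformed(2)[OF S, of ?A] U by (simp add: K_def)
    from Bochner_Integration.integrable_diff[OF this *] show ?thesis
      by simp
  qed
  ultimately have "(\<integral>r. (1 - \<alpha>) * (r * \<mu>0 - ?A) \<partial>law_r) + (\<integral>r. \<alpha> * K r \<partial>law_r) = 0"
    by (simp only: Bochner_Integration.integral_add)
  then have sum: "(1 - \<alpha>) * (P1 - ?A) + (\<integral>r. \<alpha> * K r \<partial>law_r) = 0"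
    by (simp only: integral_mult_right_zero rint(2))
  have [measurable]: "f \<in> borel_measurable borel"
    using f_density(2) by (auto simp: has_bochner_integral_iff)
  have f_pos: "0 < r" if "0 < f r" for r
    using f_support[of r] that by force
  \<comment> \<open>The sign of \<open>K r\<close> is known only for positive \<open>r\<close>,
    which carry the whole law of \<open>r\<close>.\<close>
  have pos: "AE r in law_r. 0 < r"
    using f_pos by (subst AE_density) auto
  show ?thesis
  proof (rule linorder_cases[of ?A P1])
    assume A: "?A < P1"
    have "0 \<le> K r" if "0 < r" for r
      unfolding K_def using A by (intro pool_contribution(2)[OF that]) simp
    then have "AE r in law_r. 0 \<le> \<alpha> * K r"
      using pos alpha(1) by (auto elim!: eventually_mono)
    then have "0 \<le> (\<integral>r. \<alpha> * K r \<partial>law_r)"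
      by (rule integral_nonneg_AE)
    moreover have "0 < (1 - \<alpha>) * (P1 - ?A)"
      using A alpha by simp
    ultimately show ?thesis using sum by linarith
  next
    assume A: "P1 < ?A"
    have "K r \<le> 0" if "0 < r" for r
      unfolding K_def using A by (intro pool_contribution(1)[OF that]) simp
    then have "AE r in law_r. 0 \<le> - (\<alpha> * K r)"
      using pos alpha(1) by (auto elim!: eventually_mono simp: mult_nonneg_nonpos)
    then have "0 \<le> (\<integral>r. - (\<alpha> * K r) \<partial>law_r)"
      by (rule integral_nonneg_AE)
    then have "(\<integral>r. \<alpha> * K r \<partial>law_r) \<le> 0"
      by simp
    moreover have "(1 - \<alpha>) * (P1 - ?A) < 0"
      using A alpha by (simp add: mult_pos_neg)
    ultimately show ?thesis using sum by linarith
  qed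
qed

section \<open>Types that can hide\<close>

text \<open>At the price \<open>P1\<close> both bounds of \<open>no_pool_gap\<close> apply, so the
  gap is zero. No informed type strictly prefers \<open>P1\<close> to revelation, so the integral
  drops out and only the term of the partially informed type is left.\<close>

lemma Partial_discloses:
  assumes r: "0 < r" and "r \<noteq> r0"
  shows "d (Partial r) \<noteq> Uninformed"
proof
  assume d: "d (Partial r) = Uninformed"
  have "gain v P1 \<le> \<bar>v - P1\<bar>" for v
  proof -
    have "gain v P1 = \<bar>q * (v - P1)\<bar>"
      by (simp add: algebra_simps)
    also have "\<dots> \<le> \<bar>v - P1\<bar>"
      using q by (simp add: abs_mult mult_left_le_one_le)
    finally show ?thesis .
  qed
  then have "{v. \<bar>v - P1\<bar> < gain v P1} = {}"
    by (simp add: not_less)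
  then have "pool_gap law_x (\<lambda>x. r * x) (r * \<mu>0) \<beta> q P1 P1 = (1 - \<beta>) * (r * \<mu>0 - P1)"
    by (simp add: pool_gap_def)
  with no_pool_gap[OF r d] have "r * \<mu>0 = P1"
    using beta by (simp add: price_Uninformed)
  with assms mean_pos show False
    by (simp add: P1_def)
qed

lemma hidden_value:
  assumes "t \<in> type_space" "t \<noteq> Uninformed" "d t = Uninformed"
  shows "own_value t = P1"
proof (cases t)
  case (Partial r)
  with Partial_discloses[of r] assms show ?thesis
    by (auto simp: P1_def)
next
  case (Informed r x)
  with pooled_prefers[of r x Uninformed] assms show ?thesis
    using indifferent_at_prior_price[OF q, of "r * x" P1] by (simp add: price_Uninformed)
qed (use assms in simp)

text \<open>A hiding type has value \<open>P1\<close> and earns nothing. Any other price of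
  \<open>Partial r\<close> would let it trade profitably on the price error.\<close>

lemma hidden_price:
  assumes "t \<in> type_space" "d t = Uninformed" "Partial r \<in> msgs t"
  shows "P2 (Partial r) = P1" "utility t = 0"
proof -
  have t: "t \<noteq> Uninformed" using assms(3) by auto
  show 0: "utility t = 0"
    using utility_eq[OF assms(1)] hidden_value[OF assms(1) t assms(2)] assms(2)
    by (simp add: price_Uninformed algebra_simps)
  have "gain P1 (P2 (Partial r)) \<le> 0"
    using utility_ge[OF assms(1,3)] hidden_value[OF assms(1) t assms(2)] 0 by simp
  then have "(1 - q) * (P2 (Partial r) - P1) = 0"
    by (simp add: algebra_simps)
  then show "P2 (Partial r) = P1"
    using q by simp
qed

text \<open>A hiding informed type has value \<open>P1\<close>, so \<open>r = r0\<close> would force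
  \<open>x = \<mu>0\<close>. Otherwise \<open>Partial r\<close> is sent by its namesake and yet
  priced at \<open>P1\<close> by \<open>hidden_price\<close>; informed types pooling there also have
  value \<open>P1\<close>, so the price equation gives \<open>r * \<mu>0 = P1\<close>, which
  contradicts \<open>r \<noteq> r0\<close>.\<close>

lemma Informed_discloses:
  assumes r: "0 < r" and "(r, x) \<noteq> (r0, \<mu>0)"
  shows "d (Informed r x) \<noteq> Uninformed"
proof
  assume d: "d (Informed r x) = Uninformed"
  let ?S = "sender_types d (Partial r)"
  have "r * x = P1"
    using hidden_value[OF _ _ d] r by simp
  with assms have "r \<noteq> r0"
    by (auto simp: P1_def)
  with Partial_discloses[OF r] have dP: "d (Partial r) = Partial r"
    using d_Partial_cases[OF r] by blast
  have p: "P2 (Partial r) = P1"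
    using hidden_price(1)[OF _ d] r by simp
  have S: "type_in -` ?S \<in> sets (law (Partial r))"
    using sender_sets r by simp
  have "0 < type_prob (Partial r) ?S"
    unfolding type_prob_Partial[OF S] using dP r beta integral_section_nonneg[of ?S r]
    by (simp add: add_pos_nonneg)
  from price_on_path[OF _ this] have "gap (Partial r) ?S P1 = 0"
    using p r by simp
  \<comment> \<open>Here \<open>x\<close> is arbitrary: this covers every informed type with the
    given \<open>r\<close>.\<close>
  moreover have "indicator ?S (Informed r x) * (r * x - P1) = 0" for x
    using pooled_prefers[OF r, of x "Partial r"] indifferent_at_prior_price[OF q, of "r * x" P1] p
    by (auto simp: indicator_def)
  ultimately have "r * \<mu>0 = P1"
    unfolding gap_Partial[OF S] using dP r beta by simp
  with \<open>r \<noteq> r0\<close> mean_pos show False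
    by (simp add: P1_def)
qed

lemma tie_break_discloses:
  assumes tb: "discloses_if_indifferent \<rho> d P2"
    and t: "t \<in> type_space" "Partial r \<in> msgs t"
  shows "d t \<noteq> Uninformed"
proof
  assume d: "d t = Uninformed"
  \<comment> \<open>Not trading while disclosing \<open>r\<close> attains the zero utility, so the
    tie-breaking rule applies.\<close>
  have "profit t 0 (P2 (Partial r)) = utility t"
    using hidden_price(2)[OF t(1) d t(2)] by (simp add: profit_def)
  moreover have "(0 :: real) \<in> {-1..1}" by simp
  ultimately show False
    using tb t d unfolding discloses_if_indifferent_def by blast
qed

end

end

theorem proposition1:
  fixes f g :: "real \<Rightarrow> real" and r0 \<mu>0 \<alpha> \<beta> q :: real
    and \<rho> :: "inv_type \<Rightarrow> real" and d :: "inv_type \<Rightarrow> inv_type" and P2 :: "inv_type \<Rightarrow> real"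
  assumes "disclosure_game f g r0 \<mu>0 \<alpha> \<beta> q"
    and "disclosure_game.GPFE f g r0 \<mu>0 \<alpha> \<beta> q \<rho> d P2"
  shows "(\<forall>r x. 0 < r \<longrightarrow>
            (r \<noteq> r0 \<longrightarrow> d (Partial r) \<noteq> Uninformed) \<and>
            ((r, x) \<noteq> (r0, \<mu>0) \<longrightarrow> d (Informed r x) \<noteq> Uninformed)) \<and>
         (disclosure_game.discloses_if_indifferent r0 \<mu>0 q \<rho> d P2 \<longrightarrow>
            (\<forall>r x. 0 < r \<longrightarrow> d (Partial r) \<noteq> Uninformed \<and> d (Informed r x) \<noteq> Uninformed))"
proof -
  interpret disclosure_game f g r0 \<mu>0 \<alpha> \<beta> q by fact
  note eq = assms(2)
  show ?thesis
    using Partial_discloses[OF eq] Informed_discloses[OF eq]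
      tie_break_discloses[OF eq, of "Partial _"] tie_break_discloses[OF eq, of "Informed _ _"]
    by simp
qed

end
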